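(* For all integers $d,n\ge 1$, the space $\mathbb{R}^d(n)$ of nonempty subsets of $\mathbb{R}^d$ of cardinality at most $n$, equipped with the Hausdorff metric, is an absolute Lipschitz retract.
   Context: For a metric space $X$ and an integer $n\ge 1$, $X(n)$ denotes the set of all nonempty subsets of $X$ with cardinality at most $n$, equipped with the Hausdorff metric $d_H(A,B)=\max\{\max_{a\in A}\min_{b\in B} d(a,b),\ \max_{b\in B}\min_{a\in A} d(a,b)\}$. Here $\mathbb{R}^d$ carries the Euclidean metric. A metric space $Y$ is an absolute Lipschitz retract if for every metric space $Z$ containing $Y$ (isometrically) as a subspace there exists a Lipschitz map $r\colon Z\to Y$ with $r(y)=y$ for all $y\in Y$. *)

theory Defs
  imports "HOL-Analysis.Analysis"
begin

definition hausdorff_dist :: "'a metric \<Rightarrow> 'a set \<Rightarrow> 'a set \<Rightarrow> real" where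
  "hausdorff_dist X A B =
     max (MAX a\<in>A. MIN b\<in>B. mdist X a b) (MAX b\<in>B. MIN a\<in>A. mdist X a b)"

definition finite_subsets :: "'a metric \<Rightarrow> nat \<Rightarrow> 'a set set" where
  "finite_subsets X n = {A. A \<subseteq> mspace X \<and> A \<noteq> {} \<and> finite A \<and> card A \<le> n}"

text \<open>The space \<open>X(n)\<close>. \<^const>\<open>Metric_space\<close> demands nonnegativity and symmetry of the
  distance on the whole type, whereas \<^const>\<open>hausdorff_dist\<close> is meaningless on empty or
  infinite sets; hence the value 0 outside the carrier.\<close>

definition finite_subset_metric :: "'a metric \<Rightarrow> nat \<Rightarrow> 'a set metric" where
  "finite_subset_metric X n =
     metric (finite_subsets X n,
       \<lambda>A B. if A \<in> finite_subsets X n \<and> B \<in> finite_subsets X n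
             then hausdorff_dist X A B else 0)"

lemma hausdorff_dist_le_iff:
  assumes "finite A" "A \<noteq> {}" "finite B" "B \<noteq> {}"
  shows "hausdorff_dist X A B \<le> r \<longleftrightarrow>
    (\<forall>a\<in>A. \<exists>b\<in>B. mdist X a b \<le> r) \<and> (\<forall>b\<in>B. \<exists>a\<in>A. mdist X a b \<le> r)"
  using assms by (simp add: hausdorff_dist_def Min_le_iff)

lemma hausdorff_dist_commute: "hausdorff_dist X A B = hausdorff_dist X B A"
  by (simp add: hausdorff_dist_def max.commute mdist_commute)

lemma hausdorff_dist_nonneg:
  assumes "finite A" "A \<noteq> {}" "finite B" "B \<noteq> {}"
  shows "0 \<le> hausdorff_dist X A B"
proof -
  obtain a where "a \<in> A" using assms by blast
  then obtain b where "mdist X a b \<le> hausdorff_dist X A B"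
    using hausdorff_dist_le_iff[OF assms, of X "hausdorff_dist X A B"] by auto
  then show ?thesis using mdist_nonneg[of X a b] by linarith
qed

lemma hausdorff_dist_eq_0_iff:
  assumes "finite A" "A \<noteq> {}" "A \<subseteq> mspace X" "finite B" "B \<noteq> {}" "B \<subseteq> mspace X"
  shows "hausdorff_dist X A B = 0 \<longleftrightarrow> A = B"
proof -
  have *: "mdist X a b \<le> 0 \<longleftrightarrow> a = b" if "a \<in> A" "b \<in> B" for a b
    using that assms mdist_nonneg[of X a b] mdist_zero[of a X b]
    by (metis antisym order_refl subsetD)
  have "hausdorff_dist X A B = 0 \<longleftrightarrow> hausdorff_dist X A B \<le> 0"
    using hausdorff_dist_nonneg[of A B X] assms by auto
  also have "\<dots> \<longleftrightarrow> (\<forall>a\<in>A. \<exists>b\<in>B. a = b) \<and> (\<forall>b\<in>B. \<exists>a\<in>A. a = b)"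
    using assms * by (auto simp: hausdorff_dist_le_iff)
  also have "\<dots> \<longleftrightarrow> A = B" by auto
  finally show ?thesis .
qed

lemma hausdorff_dist_triangle:
  assumes "finite A" "A \<noteq> {}" "A \<subseteq> mspace X" "finite B" "B \<noteq> {}" "B \<subseteq> mspace X"
    "finite C" "C \<noteq> {}" "C \<subseteq> mspace X"
  shows "hausdorff_dist X A C \<le> hausdorff_dist X A B + hausdorff_dist X B C"
proof -
  have AB: "(\<forall>a\<in>A. \<exists>b\<in>B. mdist X a b \<le> hausdorff_dist X A B) \<and>
      (\<forall>b\<in>B. \<exists>a\<in>A. mdist X a b \<le> hausdorff_dist X A B)"
    using hausdorff_dist_le_iff[of A B X "hausdorff_dist X A B"] assms by simp
  have BC: "(\<forall>b\<in>B. \<exists>c\<in>C. mdist X b c \<le> hausdorff_dist X B C) \<and>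
      (\<forall>c\<in>C. \<exists>b\<in>B. mdist X b c \<le> hausdorff_dist X B C)"
    using hausdorff_dist_le_iff[of B C X "hausdorff_dist X B C"] assms by simp
  have tri: "mdist X a c \<le> hausdorff_dist X A B + hausdorff_dist X B C"
    if "a \<in> A" "b \<in> B" "c \<in> C" "mdist X a b \<le> hausdorff_dist X A B"
      "mdist X b c \<le> hausdorff_dist X B C" for a b c
    using that mdist_triangle[of a X b c] assms by (smt (verit) subsetD)
  show ?thesis
    unfolding hausdorff_dist_le_iff[OF assms(1,2) assms(7,8)]
    using AB BC tri by meson
qed

lemma Metric_space_finite_subsets:
  "Metric_space (finite_subsets X n)
    (\<lambda>A B. if A \<in> finite_subsets X n \<and> B \<in> finite_subsets X n
           then hausdorff_dist X A B else 0)"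
  by unfold_locales
    (auto simp: finite_subsets_def hausdorff_dist_nonneg hausdorff_dist_commute
      hausdorff_dist_eq_0_iff hausdorff_dist_triangle)

lemma mspace_finite_subset_metric [simp]:
  "mspace (finite_subset_metric X n) = finite_subsets X n"
  unfolding finite_subset_metric_def
  by (rule Metric_space.mspace_metric[OF Metric_space_finite_subsets])

lemma mdist_finite_subset_metric:
  assumes "A \<in> finite_subsets X n" "B \<in> finite_subsets X n"
  shows "mdist (finite_subset_metric X n) A B = hausdorff_dist X A B"
  unfolding finite_subset_metric_def
  using assms by (simp add: Metric_space.mdist_metric[OF Metric_space_finite_subsets])

definition isometric_embedding :: "'a metric \<Rightarrow> 'b metric \<Rightarrow> ('a \<Rightarrow> 'b) \<Rightarrow> bool" where
  "isometric_embedding Y Z e \<longleftrightarrow>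
     e \<in> mspace Y \<rightarrow> mspace Z \<and>
     (\<forall>x\<in>mspace Y. \<forall>y\<in>mspace Y. mdist Z (e x) (e y) = mdist Y x y)"

text \<open>A definition cannot quantify over types, so the type \<open>'z\<close> of points of the ambient space
  is a parameter: \<open>Y\<close> is an absolute Lipschitz retract iff the predicate holds for every type
  \<open>'z\<close>, i.e. with \<open>'z\<close> left as a free type variable in a theorem. Since the points of \<open>Y\<close> need not
  belong to \<open>'z\<close>, the inclusion of \<open>Y\<close> in \<open>Z\<close> is an isometric embedding \<open>e\<close>, and \<open>r\<close> being the
  identity on \<open>Y\<close> reads \<open>r (e y) = y\<close>.\<close>

definition absolute_Lipschitz_retract :: "'z itself \<Rightarrow> 'a metric \<Rightarrow> bool" where
  "absolute_Lipschitz_retract TYPE('z) Y \<longleftrightarrow>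
     (\<forall>(Z :: 'z metric) e. isometric_embedding Y Z e \<longrightarrow>
        (\<exists>r. Lipschitz_continuous_map Z Y r \<and> (\<forall>y\<in>mspace Y. r (e y) = y)))"

end

theory Submission
  imports Defs
begin

text \<open>Two properties of a nonempty complete metric space \<open>Y\<close> make it a Lipschitz retract of every
  metric space \<open>Z\<close> that contains it: at every scale there are nets whose points have boundedly many neighbours
  (\<open>has_uniform_nets\<close>), and every ball of radius \<open>R\<close> can be contracted to a point inside \<open>Y\<close> by a
  homotopy which is Lipschitz with constant \<open>C\<close> in space and \<open>C R\<close> in time, where \<open>C\<close> is the same
  for all balls (\<open>ball_contraction\<close>). This is a Lipschitz version of extending a map over a Whitney
  decomposition of \<open>Z - Y\<close> by means of local contractibility.

  A Whitney item is a dyadic scale \<open>s\<close> with a point \<open>p\<close> of the net of that scale. It has a bump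
  function on \<open>Z\<close> that lives where the distance to \<open>Y\<close> is comparable to \<open>s\<close> and the distance to \<open>p\<close>
  is at most a multiple of \<open>s\<close>. The items are coloured by finitely many colours, so that items
  which are active near the same point have different colours. Given \<open>z\<close> outside \<open>Y\<close>, begin with an arbitrary point of \<open>Y\<close> about as
  close to \<open>z\<close> as possible, and go through the colours: if the item of the current colour is active
  at \<open>z\<close>, apply its contraction, up to the time given by the value of the bump at \<open>z\<close>. The
  starting point depends on \<open>z\<close> in an uncontrolled way, yet the result is Lipschitz: some bump has
  the value \<open>1\<close> at \<open>z\<close>, the full contraction at that step makes the point forget its past, and every
  later step enlarges distances by a bounded factor only. Since the number of steps is bounded, so
  is the Lipschitz constant. This is carried out in the locale \<open>whitney_retraction\<close>.

  The two properties hold for the finite subsets of a Euclidean space. Subsets of a lattice form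
  the nets. To contract the ball of radius \<open>R\<close> about a finite set \<open>A\<close>, group the points of \<open>A\<close> into
  clusters, joining points at distance at most \<open>4R\<close>. A set \<open>B\<close> in the ball consists of points near
  these clusters; move each of them along a segment to the representative of its cluster. As this
  transforms \<open>B\<close> by a map on points, it never increases the number of elements, and nearby points
  move in the same way because distinct clusters are far apart
  (\<open>sets_upto_ball_contraction\<close>).\<close>

section \<open>Colouring graphs of bounded degree\<close>

fun greedy_colour :: "(nat \<Rightarrow> nat \<Rightarrow> bool) \<Rightarrow> nat \<Rightarrow> nat" where
  "greedy_colour adj n = (LEAST c. c \<notin> greedy_colour adj ` {m. m < n \<and> adj m n})"

declare greedy_colour.simps [simp del]

lemma greedy_colour:
  assumes "card {m. m < n \<and> adj m n} \<le> D"
  shows "greedy_colour adj n \<le> D"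
    and "m < n \<Longrightarrow> adj m n \<Longrightarrow> greedy_colour adj m \<noteq> greedy_colour adj n"
proof -
  let ?S = "greedy_colour adj ` {m. m < n \<and> adj m n}"
  have "card ?S \<le> D"
    using assms card_image_le[of "{m. m < n \<and> adj m n}" "greedy_colour adj"] by simp
  moreover have "finite ?S" by simp
  ultimately have "\<not> {..D} \<subseteq> ?S"
    using card_mono[of ?S "{..D}"] by auto
  then obtain c where c: "c \<le> D" "c \<notin> ?S" by auto
  have "greedy_colour adj n \<notin> ?S"
    by (subst greedy_colour.simps) (rule LeastI, rule c(2))
  then show "m < n \<Longrightarrow> adj m n \<Longrightarrow> greedy_colour adj m \<noteq> greedy_colour adj n"
    by (metis (mono_tags, lifting) image_eqI mem_Collect_eq)
  have "greedy_colour adj n \<le> c"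
    by (subst greedy_colour.simps) (rule Least_le, rule c(2))
  then show "greedy_colour adj n \<le> D" using c(1) by simp
qed

text \<open>Enumerating the vertices and colouring greedily works because at most \<open>D\<close> neighbours of a vertex
  have been coloured before it, so that one of \<open>D + 1\<close> colours is free.\<close>

lemma countable_graph_colouring:
  fixes adj :: "'v \<Rightarrow> 'v \<Rightarrow> bool"
  assumes "countable V"
    and sym: "\<And>v w. adj v w \<Longrightarrow> adj w v"
    and deg: "\<And>v. v \<in> V \<Longrightarrow> finite {w \<in> V. adj v w} \<and> card {w \<in> V. adj v w} \<le> D"
  obtains col :: "'v \<Rightarrow> nat"
  where "\<And>v. v \<in> V \<Longrightarrow> col v \<le> D"
    and "\<And>v w. v \<in> V \<Longrightarrow> w \<in> V \<Longrightarrow> v \<noteq> w \<Longrightarrow> adj v w \<Longrightarrow> col v \<noteq> col w"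
proof -
  define num where "num = to_nat_on V"
  have inj: "inj_on num V" unfolding num_def using assms(1) by (rule inj_on_to_nat_on)
  define adj' where "adj' m n \<longleftrightarrow> (\<exists>v\<in>V. \<exists>w\<in>V. m = num v \<and> n = num w \<and> adj v w)" for m n
  have card': "card {m. m < num v \<and> adj' m (num v)} \<le> D" if v: "v \<in> V" for v
  proof -
    have "{m. m < num v \<and> adj' m (num v)} \<subseteq> num ` {w \<in> V. adj v w}"
      using inj v sym by (auto simp: adj'_def inj_on_def)
    then have "card {m. m < num v \<and> adj' m (num v)} \<le> card (num ` {w \<in> V. adj v w})"
      using deg[OF v] by (intro card_mono) auto
    also have "\<dots> \<le> card {w \<in> V. adj v w}"
      using deg[OF v] by (intro card_image_le) auto
    finally show ?thesis using deg[OF v] by linarith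
  qed
  show thesis
  proof (rule that[of "greedy_colour adj' \<circ> num"])
    fix v assume v: "v \<in> V"
    show "(greedy_colour adj' \<circ> num) v \<le> D"
      using greedy_colour(1)[of "num v" adj', OF card'[OF v]] by simp
    fix w assume w: "w \<in> V" and "v \<noteq> w" and adj: "adj v w"
    have "num v \<noteq> num w" using inj v w \<open>v \<noteq> w\<close> by (auto simp: inj_on_def)
    moreover have "adj' (num v) (num w)" "adj' (num w) (num v)"
      using v w adj sym unfolding adj'_def by blast+
    ultimately show "(greedy_colour adj' \<circ> num) v \<noteq> (greedy_colour adj' \<circ> num) w"
      using greedy_colour(2)[of "num v" adj', OF card'[OF v], of "num w"]
        greedy_colour(2)[of "num w" adj', OF card'[OF w], of "num v"]
      by (cases "num v < num w") (auto simp: not_less le_less)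
  qed
qed

section \<open>Whitney items\<close>

text \<open>The bound \<open>D\<close> may depend on the ratio \<open>K\<close> but on neither the scale nor the location. This is the
  doubling property together with separability, in the form in which it is used.\<close>

definition has_uniform_nets :: "'a metric \<Rightarrow> bool" where
  "has_uniform_nets Y \<longleftrightarrow>
     (\<forall>K. \<exists>D. \<forall>s>0. \<exists>N\<subseteq>mspace Y. countable N \<and>
        (\<forall>x\<in>mspace Y. \<exists>p\<in>N. mdist Y x p \<le> s) \<and>
        (\<forall>x\<in>mspace Y. finite {p \<in> N. mdist Y x p \<le> K * s} \<and>
                       card {p \<in> N. mdist Y x p \<le> K * s} \<le> D))"

lemma dyadic_scale:
  fixes \<rho> :: real
  assumes "\<rho> > 0"
  obtains j :: int where "2 powr j \<le> \<rho>" "\<rho> < 2 * 2 powr j"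
proof
  have "2 powr real_of_int \<lfloor>log 2 \<rho>\<rfloor> \<le> 2 powr (log 2 \<rho>)" by (intro powr_mono) auto
  then show "2 powr real_of_int \<lfloor>log 2 \<rho>\<rfloor> \<le> \<rho>" using assms by simp
  have "2 powr (log 2 \<rho>) < 2 powr (real_of_int \<lfloor>log 2 \<rho>\<rfloor> + 1)"
    by (intro powr_less_mono) (auto simp: real_of_int_floor_add_one_gt)
  then show "\<rho> < 2 * 2 powr real_of_int \<lfloor>log 2 \<rho>\<rfloor>" using assms by (simp add: powr_add)
qed

lemma dyadic_comparable:
  assumes "2 powr real_of_int j \<le> 20 * 2 powr real_of_int k"
  shows "j \<le> k + 4"
proof (rule ccontr)
  assume "\<not> j \<le> k + 4"
  then have "real_of_int k + 5 \<le> real_of_int j" by linarith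
  then have "2 powr (real_of_int k + 5) \<le> 2 powr real_of_int j" by (intro powr_mono) auto
  moreover have "2 powr (real_of_int k + 5) = 32 * 2 powr real_of_int k" by (simp add: powr_add)
  ultimately show False using assms powr_gt_zero[of 2 "real_of_int k"] by linarith
qed

text \<open>An item \<open>(j, p)\<close> has scale \<open>2\<^sup>j\<close> and centre \<open>p\<close>. Two items are in conflict when their scales differ
  by a factor of at most 20 and their centres are close on these scales; \<open>active_unique\<close> below shows
  that any two items which are active at neighbouring points are in conflict. Only nine dyadic scales
  are within a factor 20 of a given one, and each contributes a bounded number of net points, so the
  conflict graph has bounded degree.\<close>

lemma coloured_whitney_items:
  assumes "has_uniform_nets Y"
  obtains I :: "(int \<times> 'a) set" and col :: "int \<times> 'a \<Rightarrow> nat" and M :: nat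
  where "I \<subseteq> UNIV \<times> mspace Y"
    and "\<And>x \<rho>. x \<in> mspace Y \<Longrightarrow> 0 < \<rho> \<Longrightarrow>
           \<exists>i\<in>I. 2 powr real_of_int (fst i) \<le> \<rho> \<and> \<rho> < 2 * 2 powr real_of_int (fst i) \<and>
             mdist Y x (snd i) \<le> 2 powr real_of_int (fst i)"
    and "\<And>i. i \<in> I \<Longrightarrow> col i < M"
    and "\<And>i k. i \<in> I \<Longrightarrow> k \<in> I \<Longrightarrow> col i = col k \<Longrightarrow>
           2 powr real_of_int (fst i) \<le> 20 * 2 powr real_of_int (fst k) \<Longrightarrow>
           2 powr real_of_int (fst k) \<le> 20 * 2 powr real_of_int (fst i) \<Longrightarrow>
           mdist Y (snd i) (snd k) \<le> 15 * (2 powr real_of_int (fst i) + 2 powr real_of_int (fst k)) \<Longrightarrow>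
           i = k"
proof -
  obtain D where D: "\<And>s::real. s > 0 \<Longrightarrow> \<exists>N\<subseteq>mspace Y. countable N \<and>
        (\<forall>x\<in>mspace Y. \<exists>p\<in>N. mdist Y x p \<le> s) \<and>
        (\<forall>x\<in>mspace Y. finite {p \<in> N. mdist Y x p \<le> 315 * s} \<and>
                       card {p \<in> N. mdist Y x p \<le> 315 * s} \<le> D)"
    using assms unfolding has_uniform_nets_def by meson
  have "\<forall>j::int. \<exists>N\<subseteq>mspace Y. countable N \<and>
        (\<forall>x\<in>mspace Y. \<exists>p\<in>N. mdist Y x p \<le> 2 powr j) \<and>
        (\<forall>x\<in>mspace Y. finite {p \<in> N. mdist Y x p \<le> 315 * 2 powr j} \<and>
                       card {p \<in> N. mdist Y x p \<le> 315 * 2 powr j} \<le> D)"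
    by (intro allI D) simp
  from choice[OF this] obtain N :: "int \<Rightarrow> _" where N':
    "\<forall>j::int. N j \<subseteq> mspace Y \<and> countable (N j) \<and>
        (\<forall>x\<in>mspace Y. \<exists>p\<in>N j. mdist Y x p \<le> 2 powr j) \<and>
        (\<forall>x\<in>mspace Y. finite {p \<in> N j. mdist Y x p \<le> 315 * 2 powr j} \<and>
                       card {p \<in> N j. mdist Y x p \<le> 315 * 2 powr j} \<le> D)" ..
  have N: "N j \<subseteq> mspace Y" "countable (N j)"
    "x \<in> mspace Y \<Longrightarrow> \<exists>p\<in>N j. mdist Y x p \<le> 2 powr real_of_int j"
    "x \<in> mspace Y \<Longrightarrow> finite {p \<in> N j. mdist Y x p \<le> 315 * 2 powr real_of_int j}"
    "x \<in> mspace Y \<Longrightarrow> card {p \<in> N j. mdist Y x p \<le> 315 * 2 powr real_of_int j} \<le> D" for j x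
    using N'[rule_format, of j] by blast+
  define I where "I = (SIGMA j:UNIV. N j)"
  define adj where "adj = (\<lambda>(j::int, p) (k::int, q).
      2 powr j \<le> 20 * 2 powr k \<and> 2 powr k \<le> 20 * 2 powr j \<and>
      mdist Y p q \<le> 15 * (2 powr j + 2 powr k))"
  have deg: "finite {w \<in> I. adj v w} \<and> card {w \<in> I. adj v w} \<le> 9 * D" if v: "v \<in> I" for v
  proof -
    obtain j p where vp: "v = (j, p)" "p \<in> N j" using v by (auto simp: I_def)
    have p: "p \<in> mspace Y" using vp N(1) by auto
    let ?N = "\<lambda>k. {q \<in> N k. mdist Y p q \<le> 315 * 2 powr real_of_int k}"
    let ?S = "SIGMA k:{j-4..j+4}. ?N k"
    (* 15 * (2 powr j + 2 powr k) is at most 15 * 21 * 2 powr k = 315 * 2 powr k *)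
    have sub: "{w \<in> I. adj v w} \<subseteq> ?S"
    proof
      fix w assume w: "w \<in> {w \<in> I. adj v w}"
      obtain k q where kq: "w = (k, q)" "q \<in> N k" using w by (auto simp: I_def)
      have a: "2 powr j \<le> 20 * 2 powr k" "2 powr k \<le> 20 * 2 powr j"
        "mdist Y p q \<le> 15 * (2 powr j + 2 powr k)"
        using w kq vp by (auto simp: adj_def)
      show "w \<in> ?S"
        using dyadic_comparable[OF a(1)] dyadic_comparable[OF a(2)] a kq by auto
    qed
    have fin: "finite ?S" using N(4)[OF p] by auto
    have "card ?S = (\<Sum>k\<in>{j-4..j+4}. card (?N k))"
      using N(4)[OF p] by (intro card_SigmaI) auto
    also have "\<dots> \<le> (\<Sum>k\<in>{j-4..j+4}. D)" by (intro sum_mono N(5)[OF p])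
    also have "\<dots> = 9 * D" by simp
    finally show ?thesis using card_mono[OF fin sub] finite_subset[OF sub fin] by linarith
  qed
  have "countable I" unfolding I_def using N(2) by (intro countable_SIGMA) auto
  moreover have "adj w v" if "adj v w" for v w
    using that by (auto simp: adj_def mdist_commute add.commute split: prod.splits)
  ultimately obtain col where col: "\<And>v. v \<in> I \<Longrightarrow> col v \<le> 9 * D"
    "\<And>v w. v \<in> I \<Longrightarrow> w \<in> I \<Longrightarrow> v \<noteq> w \<Longrightarrow> adj v w \<Longrightarrow> col v \<noteq> col w"
    using countable_graph_colouring[of I adj "9 * D"] deg by blast
  show thesis
  proof (rule that[of I col "Suc (9 * D)"])
    show "I \<subseteq> UNIV \<times> mspace Y" using N(1) by (auto simp: I_def)
    show "\<exists>i\<in>I. 2 powr real_of_int (fst i) \<le> \<rho> \<and> \<rho> < 2 * 2 powr real_of_int (fst i) \<and>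
        mdist Y x (snd i) \<le> 2 powr real_of_int (fst i)"
      if x: "x \<in> mspace Y" and "0 < \<rho>" for x and \<rho> :: real
    proof -
      obtain j :: int where "2 powr j \<le> \<rho>" "\<rho> < 2 * 2 powr j"
        using dyadic_scale[OF \<open>0 < \<rho>\<close>] .
      moreover obtain p where "p \<in> N j" "mdist Y x p \<le> 2 powr j" using N(3)[OF x] by blast
      ultimately show ?thesis unfolding I_def by (intro bexI[of _ "(j, p)"]) auto
    qed
    show "col i < Suc (9 * D)" if "i \<in> I" for i using col(1)[OF that] by simp
    show "i = k"
      if "i \<in> I" "k \<in> I" "col i = col k"
        "2 powr real_of_int (fst i) \<le> 20 * 2 powr real_of_int (fst k)"
        "2 powr real_of_int (fst k) \<le> 20 * 2 powr real_of_int (fst i)"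
        "mdist Y (snd i) (snd k) \<le> 15 * (2 powr real_of_int (fst i) + 2 powr real_of_int (fst k))"
      for i k
    proof (rule ccontr)
      assume "i \<noteq> k"
      moreover have "adj i k" using that(4-6) by (simp add: adj_def case_prod_beta)
      ultimately show False using col(2)[OF that(1,2)] that(3) by blast
    qed
  qed
qed

section \<open>The retraction onto a uniformly contractible space\<close>

text \<open>A homotopy that contracts the ball of radius \<open>R\<close> about \<open>p\<close> to a point of \<open>Y\<close>. This point need not be
  \<open>p\<close>, nor need \<open>p\<close> stay fixed: for finite sets the clusters of \<open>p\<close> collapse as well. The homotopy
  may leave the ball.\<close>

definition ball_contraction :: "'a metric \<Rightarrow> real \<Rightarrow> 'a \<Rightarrow> real \<Rightarrow> ('a \<Rightarrow> real \<Rightarrow> 'a) \<Rightarrow> bool" where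
  "ball_contraction Y C p R h \<longleftrightarrow>
     (\<forall>x\<in>mspace Y. mdist Y x p \<le> R \<longrightarrow> h x 0 = x \<and> (\<forall>t\<in>{0..1}. h x t \<in> mspace Y)) \<and>
     (\<forall>x\<in>mspace Y. \<forall>x'\<in>mspace Y. mdist Y x p \<le> R \<longrightarrow> mdist Y x' p \<le> R \<longrightarrow>
        h x 1 = h x' 1 \<and>
        (\<forall>t\<in>{0..1}. \<forall>t'\<in>{0..1}.
           mdist Y (h x t) (h x' t') \<le> C * mdist Y x x' + C * R * \<bar>t - t'\<bar>))"

lemma ball_contractionD:
  assumes "ball_contraction Y C p R h"
    and "x \<in> mspace Y" "mdist Y x p \<le> R"
  shows "h x 0 = x" and "t \<in> {0..1} \<Longrightarrow> h x t \<in> mspace Y"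
    and "x' \<in> mspace Y \<Longrightarrow> mdist Y x' p \<le> R \<Longrightarrow> h x 1 = h x' 1"
    and "x' \<in> mspace Y \<Longrightarrow> mdist Y x' p \<le> R \<Longrightarrow> t \<in> {0..1} \<Longrightarrow> t' \<in> {0..1} \<Longrightarrow>
           mdist Y (h x t) (h x' t') \<le> C * mdist Y x x' + C * R * \<bar>t - t'\<bar>"
  using assms unfolding ball_contraction_def by blast+

lemma abs_max_diff_le:
  fixes a b :: real
  assumes "\<bar>a - a'\<bar> \<le> t" "\<bar>b - b'\<bar> \<le> t"
  shows "\<bar>max a b - max a' b'\<bar> \<le> t"
  using assms by (smt (verit))

lemma abs_min_diff_le:
  fixes a b :: real
  assumes "\<bar>a - a'\<bar> \<le> t" "\<bar>b - b'\<bar> \<le> t"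
  shows "\<bar>min a b - min a' b'\<bar> \<le> t"
  using assms by (smt (verit))

text \<open>Of the items, which have scales \<open>s\<close> and centres \<open>c\<close>, only two properties enter: they approximate
  every point of \<open>Y\<close> at every scale, and items in conflict have different colours. Nets and dyadic
  scales are a means to this end.\<close>

locale whitney_retraction =
  fixes Y :: "'a metric" and Z :: "'z metric" and e :: "'a \<Rightarrow> 'z"
    and I :: "'i set" and s :: "'i \<Rightarrow> real" and c :: "'i \<Rightarrow> 'a"
    and col :: "'i \<Rightarrow> nat" and M :: nat and C :: real
  assumes emb: "isometric_embedding Y Z e"
    and nonempty: "mspace Y \<noteq> {}"
    and complete: "mcomplete_of Y"
    and centre: "i \<in> I \<Longrightarrow> c i \<in> mspace Y"
    and scale_pos: "i \<in> I \<Longrightarrow> 0 < s i"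
    and cover: "x \<in> mspace Y \<Longrightarrow> 0 < \<rho> \<Longrightarrow>
                  \<exists>i\<in>I. s i \<le> \<rho> \<and> \<rho> < 2 * s i \<and> mdist Y x (c i) \<le> s i"
    and col_less: "i \<in> I \<Longrightarrow> col i < M"
    and col_proper: "i \<in> I \<Longrightarrow> k \<in> I \<Longrightarrow> col i = col k \<Longrightarrow>
                  s i \<le> 20 * s k \<Longrightarrow> s k \<le> 20 * s i \<Longrightarrow>
                  mdist Y (c i) (c k) \<le> 15 * (s i + s k) \<Longrightarrow> i = k"
    and contractible: "x \<in> mspace Y \<Longrightarrow> 0 < R \<Longrightarrow> \<exists>h. ball_contraction Y C x R h"
    and C_ge_1: "1 \<le> C"
begin

lemma C_nonneg: "0 \<le> C"
  using C_ge_1 by simp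

definition gap :: "'z \<Rightarrow> real" where
  "gap z = (INF x\<in>mspace Y. mdist Z z (e x))"

text \<open>The bump is \<open>1\<close> where \<open>z\<close> has distance at most \<open>9 s\<close> from the centre and at least \<open>2 s\<close> from
  \<open>Y\<close>, and it vanishes unless these distances are below \<open>10 s\<close> and above \<open>s\<close>, respectively.\<close>

definition bump :: "'i \<Rightarrow> 'z \<Rightarrow> real" where
  "bump i z = max 0 (min 1 (1 - max (mdist Z z (e (c i)) / s i - 9) (2 - gap z / s i)))"

text \<open>After \<open>n\<close> colours the approximation of \<open>z\<close> is within \<open>reach n * gap z\<close> of \<open>z\<close>. A contraction may
  move points by a multiple of the radius of its ball, so the balls have to grow with the colour;
  this is why the number of colours, and not merely the number of items active at each point, must
  be bounded.\<close>

primrec reach :: "nat \<Rightarrow> real" where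
  "reach 0 = 2"
| "reach (Suc n) = reach n + C * (20 * reach n + 20)"

definition pull :: "'i \<Rightarrow> 'a \<Rightarrow> real \<Rightarrow> 'a" where
  "pull i = (SOME h. ball_contraction Y C (c i) ((20 * reach (col i) + 20) * s i) h)"

text \<open>The choice is harmless: at most one item of each colour is active at \<open>z\<close> when \<open>z\<close> is outside \<open>Y\<close>.\<close>

definition step :: "nat \<Rightarrow> 'z \<Rightarrow> 'a \<Rightarrow> 'a" where
  "step n z x =
     (if \<exists>i\<in>I. col i = n \<and> 0 < bump i z
      then let i = (SOME i. i \<in> I \<and> col i = n \<and> 0 < bump i z) in pull i x (bump i z)
      else x)"

primrec approx :: "nat \<Rightarrow> 'z \<Rightarrow> 'a" where
  "approx 0 z = (SOME x. x \<in> mspace Y \<and> mdist Z z (e x) \<le> 2 * gap z)"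
| "approx (Suc n) z = step n z (approx n z)"

definition retract :: "'z \<Rightarrow> 'a" where
  "retract z = (if gap z = 0 then (SOME x. x \<in> mspace Y \<and> e x = z) else approx M z)"

lemma e_in [simp]: "x \<in> mspace Y \<Longrightarrow> e x \<in> mspace Z"
  using emb by (auto simp: isometric_embedding_def)

lemma dist_e: "x \<in> mspace Y \<Longrightarrow> y \<in> mspace Y \<Longrightarrow> mdist Y x y = mdist Z (e x) (e y)"
  using emb by (simp add: isometric_embedding_def)

lemma tri:
  "u \<in> mspace Z \<Longrightarrow> v \<in> mspace Z \<Longrightarrow> w \<in> mspace Z \<Longrightarrow> mdist Z u w \<le> mdist Z u v + mdist Z v w"
  by (rule mdist_triangle)

lemma dist_self [simp]: "z \<in> mspace Z \<Longrightarrow> mdist Z z z = 0"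
  by simp

lemma bdd: "bdd_below ((\<lambda>x. mdist Z z (e x)) ` mspace Y)"
  by (rule bdd_belowI[of _ 0]) auto

lemma gap_nonneg: "0 \<le> gap z"
  unfolding gap_def using nonempty by (intro cINF_greatest) auto

lemma gap_le: "x \<in> mspace Y \<Longrightarrow> gap z \<le> mdist Z z (e x)"
  unfolding gap_def using bdd by (rule cINF_lower)

lemma gap_less:
  assumes "gap z < t"
  obtains x where "x \<in> mspace Y" "mdist Z z (e x) < t"
  using assms cINF_less_iff[OF nonempty bdd] unfolding gap_def by blast

lemma gap_Lipschitz:
  assumes "z \<in> mspace Z" "z' \<in> mspace Z"
  shows "gap z \<le> gap z' + mdist Z z z'"
proof -
  have "gap z - mdist Z z z' \<le> mdist Z z' (e x)" if "x \<in> mspace Y" for x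
    using gap_le[OF that, of z] tri[of z z' "e x"] assms that by simp
  then have "gap z - mdist Z z z' \<le> gap z'"
    unfolding gap_def[of z'] using nonempty by (intro cINF_greatest) auto
  then show ?thesis by simp
qed

lemma bump_range: "bump i z \<in> {0..1}"
  by (auto simp: bump_def)

lemma bump_pos:
  assumes "i \<in> I" "0 < bump i z"
  shows "mdist Z z (e (c i)) < 10 * s i" "s i < gap z" "gap z < 10 * s i"
proof -
  have "mdist Z z (e (c i)) / s i < 10" "1 < gap z / s i"
    using assms(2) by (auto simp: bump_def max_def min_def split: if_splits)
  then show *: "mdist Z z (e (c i)) < 10 * s i" and "s i < gap z"
    using scale_pos[OF assms(1)] by (simp_all add: field_simps)
  show "gap z < 10 * s i" using * gap_le[OF centre[OF assms(1)], of z] by simp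
qed

lemma bump_Lipschitz:
  assumes "i \<in> I" "z \<in> mspace Z" "z' \<in> mspace Z"
  shows "\<bar>bump i z - bump i z'\<bar> \<le> mdist Z z z' / s i"
proof -
  have s: "0 < s i" and ci: "e (c i) \<in> mspace Z"
    using scale_pos centre assms(1) by auto
  have "\<bar>mdist Z z (e (c i)) - mdist Z z' (e (c i))\<bar> \<le> mdist Z z z'"
    using tri[OF assms(2,3) ci] tri[OF assms(3,2) ci] by (simp add: mdist_commute abs_le_iff)
  then have "\<bar>mdist Z z (e (c i)) / s i - mdist Z z' (e (c i)) / s i\<bar> \<le> mdist Z z z' / s i"
    using s by (simp add: divide_right_mono abs_divide flip: diff_divide_distrib)
  moreover have "\<bar>gap z - gap z'\<bar> \<le> mdist Z z z'"
    using gap_Lipschitz[OF assms(2,3)] gap_Lipschitz[OF assms(3,2)]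
    by (simp add: mdist_commute abs_le_iff)
  then have "\<bar>gap z / s i - gap z' / s i\<bar> \<le> mdist Z z z' / s i"
    using s by (simp add: divide_right_mono abs_divide flip: diff_divide_distrib)
  ultimately show ?thesis
    unfolding bump_def
    by (intro abs_max_diff_le abs_min_diff_le) (auto intro!: abs_max_diff_le)
qed

text \<open>If \<open>x\<close> almost realises the distance from \<open>z\<close> to \<open>Y\<close>, an item that is close to \<open>x\<close> on the scale
  of half this distance has the required property.\<close>

lemma ex_bump_eq_1:
  assumes "z \<in> mspace Z" "0 < gap z"
  obtains i where "i \<in> I" "bump i z = 1"
proof -
  obtain x where x: "x \<in> mspace Y" "mdist Z z (e x) < gap z * 2"
    using gap_less[of z "gap z * 2"] assms(2) by auto
  obtain i where i: "i \<in> I" "s i \<le> gap z / 2" "gap z / 2 < 2 * s i" "mdist Y x (c i) \<le> s i"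
    using cover[OF x(1), of "gap z / 2"] assms(2) by auto
  have "mdist Z z (e (c i)) \<le> 9 * s i"
    using tri[of z "e x" "e (c i)"] dist_e[OF x(1) centre[OF i(1)]] centre[OF i(1)] assms(1) x i
    by simp
  then have "bump i z = 1"
    using i scale_pos[OF i(1)] by (simp add: bump_def field_simps)
  then show thesis using that i(1) by blast
qed

text \<open>The Lipschitz estimate is proved first for pairs of points that are close compared to their
  distance from \<open>Y\<close>. Among the items of one colour, at most one is active at either point of such
  a pair. For all other pairs the estimate follows from
  the fact that the retraction moves a point by a multiple of its distance from \<open>Y\<close>. \<open>Z\<close> need not be
  a length space, so a local estimate at each point would not suffice.\<close>

definition near :: "'z \<Rightarrow> 'z \<Rightarrow> bool" where
  "near z z' \<longleftrightarrow> z \<in> mspace Z \<and> z' \<in> mspace Z \<and> 0 < gap z \<and> mdist Z z z' \<le> gap z / 2"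

lemma near_refl: "z \<in> mspace Z \<Longrightarrow> 0 < gap z \<Longrightarrow> near z z"
  by (simp add: near_def)

lemma near_gap:
  assumes "near z z'"
  shows "gap z \<le> 2 * gap z'" "gap z' \<le> 3/2 * gap z" "0 < gap z'"
proof -
  show "gap z \<le> 2 * gap z'" "gap z' \<le> 3/2 * gap z"
    using assms gap_Lipschitz[of z z'] gap_Lipschitz[of z' z] by (auto simp: near_def mdist_commute)
  then show "0 < gap z'" using assms by (auto simp: near_def)
qed

lemma active_near:
  assumes "near z z'" "i \<in> I" "0 < bump i z \<or> 0 < bump i z'" "w \<in> {z, z'}"
  shows "gap w \<le> 20 * s i" "mdist Z w (e (c i)) \<le> 20 * s i"
proof -
  have *: "(mdist Z z (e (c i)) < 10 * s i \<and> gap z < 10 * s i) \<or>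
        (mdist Z z' (e (c i)) < 10 * s i \<and> gap z' < 10 * s i)"
    using bump_pos[OF assms(2)] assms(3) by blast
  have n: "z \<in> mspace Z" "z' \<in> mspace Z" "mdist Z z z' \<le> gap z / 2" "mdist Z z' z \<le> gap z / 2"
    using assms(1) by (simp_all add: near_def mdist_commute)
  have ci: "e (c i) \<in> mspace Z" using centre assms(2) by simp
  show "gap w \<le> 20 * s i"
    using assms(4) near_gap[OF assms(1)] * by auto
  show "mdist Z w (e (c i)) \<le> 20 * s i"
    using assms(4) near_gap[OF assms(1)] * n tri[OF n(1,2) ci] tri[OF n(2,1) ci] by auto
qed

lemma active_unique:
  assumes "near z z'" "i \<in> I" "k \<in> I" "col i = col k" "0 < bump i z" "0 < bump k z'"
  shows "i = k"
proof -
  note i = bump_pos[OF assms(2,5)] and k = bump_pos[OF assms(3,6)] and g = near_gap[OF assms(1)]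
  have z: "z \<in> mspace Z" "z' \<in> mspace Z" "mdist Z z z' \<le> gap z / 2"
    using assms(1) by (auto simp: near_def)
  have ci: "c i \<in> mspace Y" "c k \<in> mspace Y" using centre assms by auto
  have "mdist Y (c i) (c k) \<le> mdist Z z (e (c i)) + mdist Z z z' + mdist Z z' (e (c k))"
    using tri[of "e (c i)" z "e (c k)"] tri[of z z' "e (c k)"] ci z dist_e[OF ci]
    by (simp add: mdist_commute)
  then have "mdist Y (c i) (c k) \<le> 15 * (s i + s k)"
    using i k g z by simp
  moreover have "s i \<le> 20 * s k" "s k \<le> 20 * s i" using i k g by linarith+
  ultimately show ?thesis using col_proper[OF assms(2-4)] by blast
qed

text \<open>For neighbouring points the step of a given colour can be described by one and the same item: where
  the bump vanishes, doing nothing is the same as applying the contraction up to time \<open>0\<close>.\<close>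

lemma step_cases:
  assumes "near z z'"
  obtains (idle) "\<And>i. i \<in> I \<Longrightarrow> col i = n \<Longrightarrow> \<not> 0 < bump i z"
      "\<And>x. step n z x = x" "\<And>x. step n z' x = x"
    | (active) i where "i \<in> I" "col i = n" "0 < bump i z \<or> 0 < bump i z'"
      "\<And>x. pull i x 0 = x \<Longrightarrow> step n z x = pull i x (bump i z)"
      "\<And>x. pull i x 0 = x \<Longrightarrow> step n z' x = pull i x (bump i z')"
proof -
  have zz: "near z z" and z'z': "near z' z'"
    using assms near_gap(3)[OF assms] unfolding near_def by simp_all
  have step_eq: "step n w x = pull i x (bump i w)"
    if "near w w" "i \<in> I" "col i = n" "0 < bump i w" for w x i
  proof -
    have "(SOME i. i \<in> I \<and> col i = n \<and> 0 < bump i w) = i"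
      using that active_unique[OF that(1)] by (intro some_equality) auto
    then show ?thesis using that by (auto simp: step_def Let_def)
  qed
  show thesis
  proof (cases "\<exists>i\<in>I. col i = n \<and> (0 < bump i z \<or> 0 < bump i z')")
    case True
    then obtain i where i: "i \<in> I" "col i = n" "0 < bump i z \<or> 0 < bump i z'" by blast
    have result: "step n w x = pull i x (bump i w)"
      if w: "w \<in> {z, z'}" and x: "pull i x 0 = x" for w x
    proof (cases "0 < bump i w")
      case True
      then show ?thesis using w step_eq[OF zz i(1,2)] step_eq[OF z'z' i(1,2)] by fastforce
    next
      case False
      have "k = i" if "k \<in> I" "col k = n" "0 < bump k w" for k
        using w False i(3) active_unique[OF assms i(1) that(1)]
          active_unique[OF assms that(1) i(1)] i(2) that(2,3) by auto
      then have "step n w x = x" using False by (auto simp: step_def)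
      moreover have "bump i w = 0" using False bump_range[of i w] by simp
      ultimately show ?thesis using x by simp
    qed
    show thesis
    proof (rule active[OF i])
      fix x assume "pull i x 0 = x"
      then show "step n z x = pull i x (bump i z)" "step n z' x = pull i x (bump i z')"
        by (simp_all add: result)
    qed
  next
    case False
    have "step n z x = x" "step n z' x = x" for x
      using False unfolding step_def by (meson if_not_P)+
    then show thesis using idle False by blast
  qed
qed

lemma reach_nonneg: "0 \<le> reach n"
  using C_nonneg by (induction n) auto

lemma pull_contraction:
  assumes "i \<in> I"
  shows "ball_contraction Y C (c i) ((20 * reach (col i) + 20) * s i) (pull i)"
proof -
  have "0 < (20 * reach (col i) + 20) * s i"
    using reach_nonneg[of "col i"] scale_pos[OF assms] by simp
  from contractible[OF centre[OF assms] this] show ?thesis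
    unfolding pull_def by (rule someI_ex)
qed

text \<open>The radius chosen in \<open>pull\<close> is large enough: the estimates for the contraction apply to the
  approximations of all points at which, or next to which, the item is active.\<close>

lemma in_pull_ball:
  assumes "near z z'" "i \<in> I" "0 < bump i z \<or> 0 < bump i z'" "w \<in> {z, z'}"
    and "x \<in> mspace Y" "mdist Z w (e x) \<le> reach (col i) * gap w"
  shows "mdist Y x (c i) \<le> (20 * reach (col i) + 20) * s i"
proof -
  note a = active_near[OF assms(1-4)]
  have w: "w \<in> mspace Z" using assms(1,4) by (auto simp: near_def)
  have "reach (col i) * gap w \<le> reach (col i) * (20 * s i)"
    using a(1) reach_nonneg by (rule mult_left_mono)
  then show ?thesis
    using tri[of "e x" w "e (c i)"] w assms(5,6) a(2) centre[OF assms(2)]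
      dist_e[OF assms(5) centre[OF assms(2)]]
    by (simp add: mdist_commute algebra_simps)
qed

lemma approx_bound:
  assumes "z \<in> mspace Z" "0 < gap z"
  shows "approx n z \<in> mspace Y \<and> mdist Z z (e (approx n z)) \<le> reach n * gap z"
proof (induction n)
  case 0
  obtain x where "x \<in> mspace Y" "mdist Z z (e x) < 2 * gap z"
    using gap_less[of z "2 * gap z"] assms(2) by auto
  then have "\<exists>x. x \<in> mspace Y \<and> mdist Z z (e x) \<le> 2 * gap z" by force
  from someI_ex[OF this] show ?case by simp
next
  case (Suc n)
  note nr = near_refl[OF assms]
  let ?x = "approx n z"
  let ?R = "20 * reach n + 20"
  have grow: "0 \<le> C * ?R" using C_nonneg reach_nonneg[of n] by simp
  from nr show ?case
  proof (cases rule: step_cases[where n = n])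
    case idle
    moreover have "reach n * gap z \<le> reach (Suc n) * gap z"
      using grow assms(2) by (intro mult_right_mono) auto
    ultimately show ?thesis using Suc by auto
  next
    case (active i)
    note i = active(1-3) and st = active(4)
    have x: "?x \<in> mspace Y" "mdist Y ?x (c i) \<le> ?R * s i"
      using Suc in_pull_ball[OF nr i(1,3), of z ?x] i(2) by auto
    have bc: "ball_contraction Y C (c i) (?R * s i) (pull i)"
      using pull_contraction[OF i(1)] i(2) by simp
    note D = ball_contractionD[OF bc x]
    have eq: "step n z ?x = pull i ?x (bump i z)" using st D(1) by blast
    have inY: "pull i ?x (bump i z) \<in> mspace Y" using D(2) bump_range by blast
    have s: "s i \<le> gap z" using bump_pos[OF i(1)] i(3) by force
    have "mdist Y (pull i ?x 0) (pull i ?x (bump i z)) \<le> C * mdist Y ?x ?x + C * (?R * s i) * \<bar>0 - bump i z\<bar>"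
      using D(4)[OF x, of 0 "bump i z"] bump_range by auto
    also have "\<dots> = C * ?R * s i * bump i z" using x bump_range[of i z] by simp
    also have "\<dots> \<le> C * ?R * gap z * 1"
      using s bump_range[of i z] grow scale_pos[OF i(1)] gap_nonneg[of z]
      by (intro mult_mono mult_left_mono mult_nonneg_nonneg[OF grow]) auto
    finally have "mdist Z (e ?x) (e (pull i ?x (bump i z))) \<le> C * ?R * gap z"
      using D(1) dist_e[OF x(1) inY] by simp
    then have "mdist Z z (e (pull i ?x (bump i z))) \<le> reach (Suc n) * gap z"
      using tri[of z "e ?x" "e (pull i ?x (bump i z))"] assms(1) x(1) inY Suc
      by (simp add: algebra_simps)
    then show ?thesis using eq inY by simp
  qed
qed

primrec lip :: "nat \<Rightarrow> real" where
  "lip 0 = 0"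
| "lip (Suc n) = C * lip n + C * (20 * reach n + 20)"

lemma lip_nonneg: "0 \<le> lip n"
  using C_nonneg reach_nonneg by (induction n) auto

text \<open>The last claim is where the uncontrolled starting points are forgotten: when the item contracts
  \<open>x\<close> completely, the result may as well be regarded as the complete contraction of \<open>x'\<close>, and the
  distance between \<open>x\<close> and \<open>x'\<close> does not enter the estimate.\<close>

lemma pull_approx:
  fixes z z' i
  defines "x \<equiv> approx (col i) z" and "x' \<equiv> approx (col i) z'"
    and "L \<equiv> C * (20 * reach (col i) + 20)"
  assumes nr: "near z z'" and i: "i \<in> I" "0 < bump i z \<or> 0 < bump i z'"
  shows "pull i x 0 = x" and "pull i x' 0 = x'"
    and "mdist Y (pull i x (bump i z)) (pull i x' (bump i z')) \<le> C * mdist Y x x' + L * mdist Z z z'"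
    and "bump i z = 1 \<Longrightarrow>
           mdist Y (pull i x (bump i z)) (pull i x' (bump i z')) \<le> L * mdist Z z z'"
proof -
  let ?R = "(20 * reach (col i) + 20) * s i"
  have z: "z \<in> mspace Z" "0 < gap z" "z' \<in> mspace Z" "0 < gap z'"
    using nr near_gap[OF nr] by (auto simp: near_def)
  have x: "x \<in> mspace Y" "mdist Y x (c i) \<le> ?R"
    using approx_bound[OF z(1,2), of "col i", folded x_def] in_pull_ball[OF nr i, of z x] by simp_all
  have x': "x' \<in> mspace Y" "mdist Y x' (c i) \<le> ?R"
    using approx_bound[OF z(3,4), of "col i", folded x'_def] in_pull_ball[OF nr i, of z' x'] by simp_all
  note D = ball_contractionD[OF pull_contraction[OF i(1)] x]
    and D' = ball_contractionD[OF pull_contraction[OF i(1)] x']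
  show "pull i x 0 = x" "pull i x' 0 = x'" using D(1) D'(1) by simp_all
  have "s i * \<bar>bump i z - bump i z'\<bar> \<le> mdist Z z z'"
    using bump_Lipschitz[OF i(1) z(1,3)] scale_pos[OF i(1)] by (simp add: field_simps)
  moreover have "0 \<le> L" unfolding L_def using C_nonneg reach_nonneg[of "col i"] by simp
  ultimately have "L * (s i * \<bar>bump i z - bump i z'\<bar>) \<le> L * mdist Z z z'"
    by (rule mult_left_mono)
  then have time: "C * ?R * \<bar>bump i z - bump i z'\<bar> \<le> L * mdist Z z z'"
    by (simp add: L_def mult.assoc)
  show "mdist Y (pull i x (bump i z)) (pull i x' (bump i z')) \<le> C * mdist Y x x' + L * mdist Z z z'"
    using D(4)[OF x' bump_range bump_range, of i z i z'] time by linarith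
  assume one: "bump i z = 1"
  have "mdist Y (pull i x' 1) (pull i x' (bump i z')) \<le> C * mdist Y x' x' + C * ?R * \<bar>1 - bump i z'\<bar>"
    using D'(4)[OF x' _ bump_range, of 1 i z'] by simp
  moreover have "mdist Y x' x' = 0" using x' by simp
  ultimately show "mdist Y (pull i x (bump i z)) (pull i x' (bump i z')) \<le> L * mdist Z z z'"
    using time D(3)[OF x'] by (simp add: one)
qed

text \<open>No estimate is available before the colour of an item that contracts \<open>z\<close> completely has been
  processed; this step provides one, and the later steps preserve it with larger constants.\<close>

lemma approx_Lipschitz:
  assumes nr: "near z z'" and k: "k \<in> I" "bump k z = 1" "col k < n"
  shows "mdist Y (approx n z) (approx n z') \<le> lip n * mdist Z z z'"
  using k(3)
proof (induction n)
  case (Suc n)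
  let ?x = "approx n z" and ?x' = "approx n z'" and ?d = "mdist Z z z'"
  have grow: "0 \<le> C * (20 * reach n + 20)" using C_nonneg reach_nonneg[of n] by simp
  have lip0: "0 \<le> C * lip n" using C_nonneg lip_nonneg[of n] by simp
  from nr show ?case
  proof (cases rule: step_cases[where n = n])
    case idle
    then have "col k \<noteq> n" using k by fastforce
    then have "mdist Y ?x ?x' \<le> lip n * ?d" using Suc by simp
    moreover have "lip n \<le> lip (Suc n)"
      using grow mult_right_mono[OF C_ge_1 lip_nonneg[of n]] by simp
    then have "lip n * ?d \<le> lip (Suc n) * ?d" by (rule mult_right_mono) simp
    ultimately show ?thesis using idle by simp
  next
    case (active i)
    note P = pull_approx[OF nr active(1,3), unfolded active(2)]
    have eq: "approx (Suc n) z = pull i ?x (bump i z)" "approx (Suc n) z' = pull i ?x' (bump i z')"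
      using active(4,5) P(1,2) by simp_all
    show ?thesis
    proof (cases "col k = n")
      case True
      have "near z z" using nr by (auto simp: near_def)
      then have "i = k"
        using active(1-3) k True active_unique[OF _ active(1) k(1), of z z]
          active_unique[OF nr k(1) active(1)] by auto
      then have "mdist Y (approx (Suc n) z) (approx (Suc n) z') \<le> C * (20 * reach n + 20) * ?d"
        using P(4) k(2) unfolding eq by simp
      also have "\<dots> \<le> lip (Suc n) * ?d" using lip0 by (intro mult_right_mono) auto
      finally show ?thesis .
    next
      case False
      then have "C * mdist Y ?x ?x' \<le> C * (lip n * ?d)"
        using Suc C_nonneg by (intro mult_left_mono) auto
      then show ?thesis using P(3) unfolding eq by (simp add: algebra_simps)
    qed
  qed
qed simp

text \<open>This is where completeness enters: the points at distance \<open>0\<close> from \<open>Y\<close> belong to \<open>Y\<close>.\<close>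

lemma gap_eq_0:
  assumes z: "z \<in> mspace Z" and "gap z = 0"
  shows "\<exists>x\<in>mspace Y. e x = z"
proof -
  interpret MY: Metric_space "mspace Y" "mdist Y" by (rule Metric_space_mspace_mdist)
  have "\<exists>x\<in>mspace Y. mdist Z z (e x) < inverse (real (Suc n))" for n
    using gap_less[of z "inverse (real (Suc n))"] assms(2) by auto
  then obtain x where x: "\<And>n. x n \<in> mspace Y" "\<And>n. mdist Z z (e (x n)) < inverse (real (Suc n))"
    by metis
  have small: "\<exists>N. \<forall>n\<ge>N. mdist Z z (e (x n)) < \<epsilon>" if "0 < \<epsilon>" for \<epsilon>
  proof -
    from reals_Archimedean[OF that] obtain N where N: "inverse (real (Suc N)) < \<epsilon>" by blast
    have "mdist Z z (e (x n)) < \<epsilon>" if "n \<ge> N" for n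
    proof -
      have "inverse (real (Suc n)) \<le> inverse (real (Suc N))" using that by (simp add: field_simps)
      then show ?thesis using x(2)[of n] N by linarith
    qed
    then show ?thesis by blast
  qed
  have "MY.MCauchy x"
    unfolding MY.MCauchy_def
  proof (intro conjI allI impI)
    fix \<epsilon> :: real assume "0 < \<epsilon>"
    then obtain N where N: "\<forall>n\<ge>N. mdist Z z (e (x n)) < \<epsilon> / 2" using small[of "\<epsilon> / 2"] by auto
    have "mdist Y (x n) (x n') < \<epsilon>" if "N \<le> n" "N \<le> n'" for n n'
    proof -
      have "mdist Z z (e (x n)) < \<epsilon> / 2" "mdist Z z (e (x n')) < \<epsilon> / 2" using N that by auto
      then show ?thesis
        using tri[of "e (x n)" z "e (x n')"] z x(1) dist_e[of "x n" "x n'"] by (simp add: mdist_commute)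
    qed
    then show "\<exists>N. \<forall>n n'. N \<le> n \<longrightarrow> N \<le> n' \<longrightarrow> mdist Y (x n) (x n') < \<epsilon>" by blast
  qed (use x(1) in auto)
  then obtain l where "limitin MY.mtopology x l sequentially"
    using complete unfolding mcomplete_of_def MY.mcomplete_def by blast
  then have l: "l \<in> mspace Y" and lim: "\<And>\<epsilon>. 0 < \<epsilon> \<Longrightarrow> \<exists>N. \<forall>n\<ge>N. mdist Y (x n) l < \<epsilon>"
    unfolding MY.limit_metric_sequentially by blast+
  have "mdist Z z (e l) \<le> 0"
  proof (rule field_le_epsilon)
    fix \<epsilon> :: real assume "0 < \<epsilon>"
    then obtain N N' where "\<forall>n\<ge>N. mdist Z z (e (x n)) < \<epsilon> / 2" "\<forall>n\<ge>N'. mdist Y (x n) l < \<epsilon> / 2"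
      using small[of "\<epsilon> / 2"] lim[of "\<epsilon> / 2"] by auto
    then have "mdist Z z (e (x (max N N'))) < \<epsilon> / 2" "mdist Y (x (max N N')) l < \<epsilon> / 2" by auto
    then show "mdist Z z (e l) \<le> 0 + \<epsilon>"
      using tri[of z "e (x (max N N'))" "e l"] z l x(1) dist_e[of "x (max N N')" l] by simp
  qed
  then have "mdist Z z (e l) = 0" by (simp add: order_antisym)
  then show ?thesis using l z by auto
qed

lemma retract_bound:
  assumes "z \<in> mspace Z"
  shows "retract z \<in> mspace Y \<and> mdist Z z (e (retract z)) \<le> reach M * gap z"
proof (cases "gap z = 0")
  case True
  from someI_ex[OF gap_eq_0[OF assms True, unfolded Bex_def]]
  show ?thesis using True assms by (simp add: retract_def)
next
  case False
  then have "0 < gap z" using gap_nonneg[of z] by simp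
  then show ?thesis using approx_bound[OF assms, of M] False by (simp add: retract_def)
qed

lemma retract_e:
  assumes "x \<in> mspace Y"
  shows "retract (e x) = x"
proof -
  have "gap (e x) = 0"
    using gap_le[OF assms, of "e x"] gap_nonneg[of "e x"] dist_self[OF e_in[OF assms]] by linarith
  then have "mdist Z (e x) (e (retract (e x))) = 0"
    using retract_bound[of "e x"] assms by (simp add: order_antisym)
  then have "mdist Y x (retract (e x)) = 0"
    using retract_bound[of "e x"] dist_e assms by simp
  then show ?thesis using retract_bound[of "e x"] assms by simp
qed

lemma retract_near:
  assumes "near z z'"
  shows "mdist Y (retract z) (retract z') \<le> lip M * mdist Z z z'"
proof -
  have z: "z \<in> mspace Z" "0 < gap z" "0 < gap z'"
    using assms near_gap[OF assms] by (auto simp: near_def)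
  obtain k where "k \<in> I" "bump k z = 1" using ex_bump_eq_1[OF z(1,2)] .
  then show ?thesis
    using approx_Lipschitz[OF assms, of k M] col_less z by (simp add: retract_def)
qed

lemma Lipschitz_retract: "Lipschitz_continuous_map Z Y retract"
proof -
  define L where "L = max (lip M) (4 * reach M + 1)"
  have "mdist Y (retract z) (retract z') \<le> L * mdist Z z z'"
    if z: "z \<in> mspace Z" "z' \<in> mspace Z" for z z'
  proof -
    have L: "lip M * mdist Z z z' \<le> L * mdist Z z z'" "(4 * reach M + 1) * mdist Z z z' \<le> L * mdist Z z z'"
      unfolding L_def by (intro mult_right_mono; simp)+
    consider "near z z'" | "near z' z" |
        "gap z \<le> 2 * mdist Z z z'" "gap z' \<le> 2 * mdist Z z z'"
    proof (cases "2 * mdist Z z z' < gap z \<or> 2 * mdist Z z z' < gap z'")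
      case True
      moreover have "0 \<le> mdist Z z z'" by simp
      ultimately have "near z z' \<or> near z' z"
        unfolding near_def mdist_commute[of Z z' z] using z by linarith
      then show thesis using that by blast
    qed (use that in auto)
    then show ?thesis
    proof cases
      case 1
      then show ?thesis using retract_near[OF 1] L(1) by linarith
    next
      case 2
      then show ?thesis using retract_near[OF 2] L(1)
        unfolding mdist_commute[of Z z' z] mdist_commute[of Y "retract z'"] by linarith
    next
      case 3
      note b = retract_bound[OF z(1)] and b' = retract_bound[OF z(2)]
      have "reach M * gap z \<le> reach M * (2 * mdist Z z z')" "reach M * gap z' \<le> reach M * (2 * mdist Z z z')"
        using 3 reach_nonneg by (auto intro: mult_left_mono)
      moreover have "mdist Y (retract z) (retract z') \<le>
          mdist Z z (e (retract z)) + mdist Z z z' + mdist Z z' (e (retract z'))"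
        using tri[of "e (retract z)" z "e (retract z')"] tri[of z z' "e (retract z')"]
          z b b' dist_e[of "retract z" "retract z'"] by (simp add: mdist_commute)
      ultimately show ?thesis using b b' L(2) by (simp add: algebra_simps)
    qed
  qed
  moreover have "retract \<in> mspace Z \<rightarrow> mspace Y" using retract_bound by blast
  ultimately show ?thesis unfolding Lipschitz_continuous_map_def by blast
qed

end

theorem absolute_Lipschitz_retract_if_nets_and_contractions:
  assumes "mspace Y \<noteq> {}" "mcomplete_of Y" "has_uniform_nets Y" "1 \<le> C"
    and contr: "\<And>p R. p \<in> mspace Y \<Longrightarrow> 0 < R \<Longrightarrow> \<exists>h. ball_contraction Y C p R h"
  shows "absolute_Lipschitz_retract TYPE('z) Y"
  unfolding absolute_Lipschitz_retract_def
proof (intro allI impI)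
  fix Z :: "'z metric" and e
  assume emb: "isometric_embedding Y Z e"
  show "\<exists>r. Lipschitz_continuous_map Z Y r \<and> (\<forall>y\<in>mspace Y. r (e y) = y)"
  proof (rule coloured_whitney_items[OF assms(3)])
    fix I :: "(int \<times> 'a) set" and col :: "int \<times> 'a \<Rightarrow> nat" and M :: nat
    assume I: "I \<subseteq> UNIV \<times> mspace Y"
      and cover: "\<And>x \<rho>. x \<in> mspace Y \<Longrightarrow> 0 < \<rho> \<Longrightarrow>
           \<exists>i\<in>I. 2 powr real_of_int (fst i) \<le> \<rho> \<and> \<rho> < 2 * 2 powr real_of_int (fst i) \<and>
             mdist Y x (snd i) \<le> 2 powr real_of_int (fst i)"
      and col: "\<And>i. i \<in> I \<Longrightarrow> col i < M"
      and proper: "\<And>i k. i \<in> I \<Longrightarrow> k \<in> I \<Longrightarrow> col i = col k \<Longrightarrow>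
           2 powr real_of_int (fst i) \<le> 20 * 2 powr real_of_int (fst k) \<Longrightarrow>
           2 powr real_of_int (fst k) \<le> 20 * 2 powr real_of_int (fst i) \<Longrightarrow>
           mdist Y (snd i) (snd k) \<le> 15 * (2 powr real_of_int (fst i) + 2 powr real_of_int (fst k)) \<Longrightarrow>
           i = k"
    interpret whitney_retraction Y Z e I "\<lambda>i. 2 powr real_of_int (fst i)" snd col M C
    proof (rule whitney_retraction.intro)
      show "snd i \<in> mspace Y" if "i \<in> I" for i using I that by auto
    qed (fact emb assms(1,2,4) cover col proper contr | simp)+
    show ?thesis using Lipschitz_retract retract_e by blast
  qed
qed

section \<open>The metric space of finite subsets\<close>

abbreviation (input) sets_upto :: "nat \<Rightarrow> 'a::metric_space set metric" where
  "sets_upto n \<equiv> finite_subset_metric euclidean_metric n"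

(* Membership in the space is resolved by in_sets_upto below, in one step. *)
declare mspace_finite_subset_metric [simp del]

lemma in_sets_upto:
  "A \<in> mspace (sets_upto n) \<longleftrightarrow> A \<noteq> {} \<and> finite A \<and> card A \<le> n"
  by (auto simp: finite_subsets_def mspace_finite_subset_metric)

lemma image_in_sets_upto:
  "A \<in> mspace (sets_upto n) \<Longrightarrow> f ` A \<in> mspace (sets_upto n)"
  unfolding in_sets_upto using card_image_le[of A f] by auto

lemma mdist_sets_upto_le_iff:
  assumes "A \<in> mspace (sets_upto n)" "B \<in> mspace (sets_upto n)"
  shows "mdist (sets_upto n) A B \<le> r \<longleftrightarrow>
    (\<forall>a\<in>A. \<exists>b\<in>B. dist a b \<le> r) \<and> (\<forall>b\<in>B. \<exists>a\<in>A. dist a b \<le> r)"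
proof -
  have "mdist (sets_upto n) A B = hausdorff_dist euclidean_metric A B"
    by (rule mdist_finite_subset_metric) (use assms in \<open>simp_all add: mspace_finite_subset_metric\<close>)
  moreover have "A \<noteq> {}" "finite A" "B \<noteq> {}" "finite B"
    using assms unfolding in_sets_upto by blast+
  ultimately show ?thesis by (simp add: hausdorff_dist_le_iff)
qed

lemma mdist_sets_uptoD:
  assumes "A \<in> mspace (sets_upto n)" "B \<in> mspace (sets_upto n)" "mdist (sets_upto n) A B \<le> r"
  shows "a \<in> A \<Longrightarrow> \<exists>b\<in>B. dist a b \<le> r" "b \<in> B \<Longrightarrow> \<exists>a\<in>A. dist a b \<le> r"
  using assms mdist_sets_upto_le_iff by blast+

section \<open>Contracting balls of finite sets\<close>

text \<open>The clusters are the connected components of the graph that joins points at distance at most \<open>r\<close>.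
  Connected points are joined by a path with no more steps than there are edges, and, counted as ordered
  pairs, there are at most \<open>n\<^sup>2\<close> edges. This bounds the diameter of a cluster by a multiple of \<open>r\<close>.\<close>

lemma cluster_representatives:
  fixes A :: "'a::metric_space set"
  assumes "finite A" "card A \<le> n" "0 \<le> r"
  shows "\<exists>rep. (\<forall>a\<in>A. dist a (rep a) \<le> real (n * n) * r) \<and>
    (\<forall>a\<in>A. \<forall>b\<in>A. dist a b \<le> r \<longrightarrow> rep a = rep b)"
proof -
  define E where "E = {(a, b). a \<in> A \<and> b \<in> A \<and> dist a b \<le> r}"
  have E: "E \<subseteq> A \<times> A" "sym E" by (auto simp: E_def sym_def dist_commute)
  have fin: "finite E" using E(1) assms(1) by (auto intro: finite_subset)
  have "card E \<le> card (A \<times> A)" using E(1) assms(1) by (intro card_mono) auto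
  also have "\<dots> \<le> n * n" using assms(2) by (simp add: card_cartesian_product mult_le_mono)
  finally have cardE: "card E \<le> n * n" .
  have path: "dist a b \<le> real k * r" if "(a, b) \<in> E ^^ k" for a b k
    using that
  proof (induction k arbitrary: b)
    case (Suc k)
    then obtain c where c: "(a, c) \<in> E ^^ k" "dist c b \<le> r" by (auto simp: E_def)
    then show ?case using Suc.IH[OF c(1)] dist_triangle[of a b c] by (simp add: algebra_simps)
  qed simp
  define rep where "rep a = (SOME b. (a, b) \<in> E\<^sup>*)" for a
  have rep: "(a, rep a) \<in> E\<^sup>*" for a
    unfolding rep_def by (rule someI[of _ a]) simp
  show ?thesis
  proof (intro exI[of _ rep] conjI ballI impI)
    fix a assume "a \<in> A"
    obtain k where "k \<le> card E" "(a, rep a) \<in> E ^^ k"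
      using rep[of a] unfolding rtrancl_finite_eq_relpow[OF fin] by blast
    then have "dist a (rep a) \<le> real k * r" "real k \<le> real (n * n)"
      using path cardE by (auto simp del: of_nat_mult)
    then show "dist a (rep a) \<le> real (n * n) * r"
      using assms(3) by (meson mult_right_mono order_trans)
  next
    fix a b assume "a \<in> A" "b \<in> A" "dist a b \<le> r"
    then have "(a, b) \<in> E" by (simp add: E_def)
    then have "(a, b) \<in> E\<^sup>*" ..
    moreover have "(b, a) \<in> E\<^sup>*" using symD[OF sym_rtrancl[OF E(2)] calculation] .
    ultimately have "(a, c) \<in> E\<^sup>* \<longleftrightarrow> (b, c) \<in> E\<^sup>*" for c
      using rtrancl_trans[of a b E c] rtrancl_trans[of b a E c] by blast
    then show "rep a = rep b" unfolding rep_def by simp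
  qed
qed

text \<open>Let \<open>p\<close> and \<open>q\<close> be points of two sets in the ball of radius \<open>R\<close> about \<open>A\<close>. The sets are at distance at
  most \<open>2R\<close>, so only pairs with \<open>dist p q \<le> 2R\<close> have to be compared, and points of \<open>A\<close> near such \<open>p\<close>
  and \<open>q\<close> are at distance at most \<open>4R\<close>, hence in the same cluster. Thus \<open>p\<close> and \<open>q\<close> are attracted to
  the same representative. All sets in the ball end as the set of all representatives, because
  each of them has a point near every point of \<open>A\<close>.\<close>

lemma sets_upto_ball_contraction:
  fixes A :: "'a::real_normed_vector set"
  assumes A: "A \<in> mspace (sets_upto n)" and R: "0 < R"
  shows "\<exists>h. ball_contraction (sets_upto n) (real (4 * n * n + 1)) A R h"
proof -
  let ?Y = "sets_upto n :: 'a set metric"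
  define K where "K = real (4 * n * n + 1)"
  have K: "1 \<le> K" by (simp add: K_def)
  have finA: "finite A" "card A \<le> n" using A by (simp_all add: in_sets_upto)
  have "\<exists>rep. (\<forall>a\<in>A. dist a (rep a) \<le> real (n * n) * (4 * R)) \<and>
    (\<forall>a\<in>A. \<forall>b\<in>A. dist a b \<le> 4 * R \<longrightarrow> rep a = rep b)"
    using R by (intro cluster_representatives[OF finA]) simp
  then obtain rep where rep: "\<And>a. a \<in> A \<Longrightarrow> dist a (rep a) \<le> real (n * n) * (4 * R)"
    "\<And>a b. a \<in> A \<Longrightarrow> b \<in> A \<Longrightarrow> dist a b \<le> 4 * R \<Longrightarrow> rep a = rep b"
    by blast
  define P where "P = {p. \<exists>a\<in>A. dist p a \<le> R}"
  define nearest where "nearest p = (SOME a. a \<in> A \<and> dist p a \<le> R)" for p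
  have nearest: "nearest p \<in> A" "dist p (nearest p) \<le> R" if "p \<in> P" for p
    using someI_ex[of "\<lambda>a. a \<in> A \<and> dist p a \<le> R"] that unfolding nearest_def P_def by blast+
  define ctr where "ctr p = rep (nearest p)" for p
  have ctr_dist: "dist p (ctr p) \<le> K * R" if "p \<in> P" for p
    using nearest[OF that] rep(1)[of "nearest p"] dist_triangle[of p "ctr p" "nearest p"]
    by (simp add: ctr_def K_def algebra_simps)
  have ctr_eq: "ctr p = ctr q" if "p \<in> P" "q \<in> P" "dist p q \<le> 2 * R" for p q
    unfolding ctr_def
  proof (rule rep(2))
    show "dist (nearest p) (nearest q) \<le> 4 * R"
      using nearest[OF that(1)] nearest[OF that(2)] that(3)
        dist_triangle[of "nearest p" "nearest q" p] dist_triangle[of p "nearest q" q]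
      by (simp add: dist_commute)
  qed (use nearest that in auto)
  define g where "g t p = (1 - t) *\<^sub>R p + t *\<^sub>R ctr p" for t p
  have g_dist: "dist (g t p) (g t' q) \<le> K * d + K * R * \<bar>t - t'\<bar>"
    if "p \<in> P" "q \<in> P" "dist p q \<le> d" "d \<le> 2 * R" "t \<in> {0..1}" for p q d t t'
  proof -
    have "ctr p = ctr q" using ctr_eq that by simp
    then have "g t p - g t' q = (1 - t) *\<^sub>R (p - q) + (t' - t) *\<^sub>R (q - ctr q)"
      by (simp add: g_def algebra_simps)
    then have "dist (g t p) (g t' q) \<le> \<bar>1 - t\<bar> * dist p q + \<bar>t' - t\<bar> * dist q (ctr q)"
      unfolding dist_norm using norm_triangle_ineq[of "(1 - t) *\<^sub>R (p - q)" "(t' - t) *\<^sub>R (q - ctr q)"]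
      by simp
    also have "\<dots> \<le> 1 * d + \<bar>t' - t\<bar> * (K * R)"
      using that ctr_dist[OF that(2)] by (intro add_mono mult_mono) auto
    also have "\<dots> \<le> K * d + K * R * \<bar>t - t'\<bar>"
    proof -
      have "0 \<le> d" using that(3) zero_le_dist[of p q] by linarith
      then have "1 * d \<le> K * d" using K by (rule mult_right_mono[rotated])
      moreover have "\<bar>t' - t\<bar> * (K * R) = K * R * \<bar>t - t'\<bar>" by (simp add: abs_minus_commute)
      ultimately show ?thesis by linarith
    qed
    finally show ?thesis .
  qed
  define h where "h x t = g t ` x" for x t
  have in_P: "p \<in> P" if "x \<in> mspace ?Y" "mdist ?Y x A \<le> R" "p \<in> x" for x p
    using mdist_sets_uptoD(1)[OF that(1) A that(2,3)] by (simp add: P_def)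
  have h_end: "h x 1 = rep ` A" if x: "x \<in> mspace ?Y" "mdist ?Y x A \<le> R" for x
  proof
    show "h x 1 \<subseteq> rep ` A"
      using nearest(1)[OF in_P[OF x]] by (auto simp: h_def g_def ctr_def)
    show "rep ` A \<subseteq> h x 1"
    proof
      fix c assume "c \<in> rep ` A"
      then obtain a where a: "a \<in> A" "c = rep a" by blast
      obtain p where p: "p \<in> x" "dist p a \<le> R" using mdist_sets_uptoD(2)[OF x(1) A x(2) a(1)] by blast
      have "dist (nearest p) a \<le> 4 * R"
        using nearest[OF in_P[OF x p(1)]] p(2) dist_triangle3[of "nearest p" a p] R by simp
      then have "rep a = ctr p"
        unfolding ctr_def using rep(2)[OF nearest(1)[OF in_P[OF x p(1)]] a(1)] by simp
      then show "c \<in> h x 1" using p(1) a(2) by (auto simp: h_def g_def)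
    qed
  qed
  have "ball_contraction ?Y K A R h"
    unfolding ball_contraction_def
  proof (intro conjI ballI impI)
    fix x assume x: "x \<in> mspace ?Y" "mdist ?Y x A \<le> R"
    show "h x 0 = x" by (simp add: h_def g_def)
    show "h x t \<in> mspace ?Y" for t unfolding h_def using x(1) by (rule image_in_sets_upto)
    fix x' assume x': "x' \<in> mspace ?Y" "mdist ?Y x' A \<le> R"
    show "h x 1 = h x' 1" using h_end x x' by simp
    fix t t' :: real assume t: "t \<in> {0..1}" "t' \<in> {0..1}"
    let ?d = "mdist ?Y x x'"
    have d: "?d \<le> 2 * R"
      using mdist_triangle[OF x(1) A x'(1)] x(2) x'(2) by (simp add: mdist_commute)
    have "\<exists>q\<in>x'. dist (g t p) (g t' q) \<le> K * ?d + K * R * \<bar>t - t'\<bar>" if p: "p \<in> x" for p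
    proof -
      obtain q where q: "q \<in> x'" "dist p q \<le> ?d"
        using mdist_sets_uptoD(1)[OF x(1) x'(1) order_refl p] by blast
      show ?thesis using g_dist[OF in_P[OF x p] in_P[OF x' q(1)] q(2) d t(1)] q(1) by (rule bexI)
    qed
    moreover have "\<exists>p\<in>x. dist (g t p) (g t' q) \<le> K * ?d + K * R * \<bar>t - t'\<bar>" if q: "q \<in> x'" for q
    proof -
      obtain p where p: "p \<in> x" "dist p q \<le> ?d"
        using mdist_sets_uptoD(2)[OF x(1) x'(1) order_refl q] by blast
      show ?thesis using g_dist[OF in_P[OF x p(1)] in_P[OF x' q] p(2) d t(1)] p(1) by (rule bexI)
    qed
    ultimately show "mdist ?Y (h x t) (h x' t') \<le> K * ?d + K * R * \<bar>t - t'\<bar>"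
      unfolding h_def mdist_sets_upto_le_iff[OF image_in_sets_upto[OF x(1)] image_in_sets_upto[OF x'(1)]]
      by (simp only: ball_simps bex_simps) blast
  qed
  then show ?thesis unfolding K_def by blast
qed

section \<open>Completeness\<close>

lemma ex_enumeration_lessThan:
  assumes "finite A" "A \<noteq> {}" "card A \<le> n"
  shows "\<exists>f. A = f ` {..<n::nat}"
proof -
  obtain h where h: "bij_betw h {0..<card A} A" using ex_bij_betw_nat_finite[OF assms(1)] by blast
  have "0 < card A" using assms by (simp add: card_gt_0_iff)
  define f where "f i = (if i < card A then h i else h 0)" for i
  have "A = f ` {0..<card A}" using h by (auto simp: bij_betw_def f_def)
  also have "\<dots> = f ` {..<n}"
  proof
    show "f ` {0..<card A} \<subseteq> f ` {..<n}" using assms(3) by (intro image_mono) auto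
    have "f i \<in> f ` {0..<card A}" for i
      using \<open>0 < card A\<close> by (cases "i < card A") (auto simp: f_def intro: image_eqI[of _ _ 0])
    then show "f ` {..<n} \<subseteq> f ` {0..<card A}" by blast
  qed
  finally show ?thesis by blast
qed

lemma common_convergent_subsequence:
  fixes f :: "nat \<Rightarrow> nat \<Rightarrow> 'a::metric_space"
  assumes "compact S" "\<And>k i. i < n \<Longrightarrow> f k i \<in> S"
  shows "\<exists>r l. strict_mono (r :: nat \<Rightarrow> nat) \<and> (\<forall>i<n. (\<lambda>k. f (r k) i) \<longlonglongrightarrow> l i)"
  using assms(2)
proof (induction n)
  case 0
  show ?case using strict_mono_id by auto
next
  case (Suc n)
  then obtain r l where r: "strict_mono r" "\<And>i. i < n \<Longrightarrow> (\<lambda>k. f (r k) i) \<longlonglongrightarrow> l i" by auto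
  have "\<forall>k. f (r k) n \<in> S" using Suc.prems by simp
  then obtain m r' where r': "strict_mono r'" "((\<lambda>k. f (r k) n) \<circ> r') \<longlonglongrightarrow> m"
    using assms(1) unfolding compact_def by meson
  have "(\<lambda>k. f ((r \<circ> r') k) i) \<longlonglongrightarrow> (l(n := m)) i" if "i < Suc n" for i
  proof (cases "i = n")
    case True
    then show ?thesis using r'(2) by (simp add: o_def)
  next
    case False
    then show ?thesis using LIMSEQ_subseq_LIMSEQ[OF r(2) r'(1), of i] that by (simp add: o_def)
  qed
  moreover have "strict_mono (r \<circ> r')" using r(1) r'(1) by (rule strict_mono_o)
  ultimately show ?case by blast
qed

text \<open>Enumerate the members of a Cauchy sequence as \<open>n\<close>-tuples, with repetitions. These tuples are bounded,
  so that a subsequence converges in every coordinate. It suffices that the sets of this subsequence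
  converge, and they converge to the set of coordinates of the limit tuple.\<close>

lemma mcomplete_sets_upto: "mcomplete_of (sets_upto n :: 'a::heine_borel set metric)"
proof -
  let ?Y = "sets_upto n :: 'a set metric"
  interpret Y: Metric_space "mspace ?Y" "mdist ?Y" by (rule Metric_space_mspace_mdist)
  have "\<exists>L. limitin Y.mtopology \<sigma> L sequentially" if Cauchy: "Y.MCauchy \<sigma>" for \<sigma>
  proof -
    have \<sigma>: "\<sigma> k \<in> mspace ?Y" for k using Cauchy by (auto simp: Y.MCauchy_def)
    obtain N where N: "\<And>k. N \<le> k \<Longrightarrow> mdist ?Y (\<sigma> k) (\<sigma> N) < 1"
      using Cauchy unfolding Y.MCauchy_def by (meson order_refl zero_less_one)
    define S where "S = (\<Union>a\<in>\<sigma> N. cball a 1)"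
    have "compact S" unfolding S_def using \<sigma>[of N] by (intro compact_UN) (auto simp: in_sets_upto)
    have S: "\<sigma> (N + k) \<subseteq> S" for k
      using mdist_sets_uptoD(1)[OF \<sigma> \<sigma> less_imp_le[OF N[of "N + k"]]]
      by (auto simp: S_def dist_commute)
    have "\<exists>f. \<sigma> (N + k) = f ` {..<n}" for k
      using \<sigma>[of "N + k"] by (intro ex_enumeration_lessThan) (auto simp: in_sets_upto)
    then obtain f where f: "\<And>k. \<sigma> (N + k) = f k ` {..<n}" by metis
    have "f k i \<in> S" if "i < n" for k i using S[of k] f[of k] that by auto
    then obtain r l where r: "strict_mono (r :: nat \<Rightarrow> nat)" and l: "\<And>i. i < n \<Longrightarrow> (\<lambda>k. f (r k) i) \<longlonglongrightarrow> l i"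
      using common_convergent_subsequence[OF \<open>compact S\<close>, of n f] by auto
    define L where "L = l ` {..<n}"
    have "{..<n} \<noteq> {}" using f[of 0] \<sigma>[of "N + 0"] by (auto simp: in_sets_upto)
    then have L: "L \<in> mspace ?Y"
      using card_image_le[of "{..<n}" l] by (simp add: L_def in_sets_upto)
    have "limitin Y.mtopology (\<sigma> \<circ> (\<lambda>k. N + r k)) L sequentially"
      unfolding Y.limit_metric_sequentially
    proof (intro conjI allI impI L)
      fix \<epsilon> :: real assume "0 < \<epsilon>"
      have "\<forall>\<^sub>F k in sequentially. \<forall>i\<in>{..<n}. dist (f (r k) i) (l i) < \<epsilon> / 2"
      proof (intro eventually_ball_finite ballI)
        fix i assume "i \<in> {..<n}"
        then show "\<forall>\<^sub>F k in sequentially. dist (f (r k) i) (l i) < \<epsilon> / 2"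
          using tendstoD[OF l, of i "\<epsilon> / 2"] \<open>0 < \<epsilon>\<close> by simp
      qed simp
      then obtain M where M: "\<And>k i. M \<le> k \<Longrightarrow> i < n \<Longrightarrow> dist (f (r k) i) (l i) < \<epsilon> / 2"
        by (auto simp: eventually_sequentially)
      have "mdist ?Y (\<sigma> (N + r k)) L < \<epsilon>" if "M \<le> k" for k
      proof -
        have "mdist ?Y (\<sigma> (N + r k)) L \<le> \<epsilon> / 2"
          unfolding mdist_sets_upto_le_iff[OF \<sigma> L]
          using M[OF that] by (fastforce simp: f L_def intro: less_imp_le)
        then show ?thesis using \<open>0 < \<epsilon>\<close> by simp
      qed
      then show "\<exists>M. \<forall>k\<ge>M. (\<sigma> \<circ> (\<lambda>k. N + r k)) k \<in> mspace ?Y \<and> mdist ?Y ((\<sigma> \<circ> (\<lambda>k. N + r k)) k) L < \<epsilon>"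
        using \<sigma> by auto
    qed
    moreover have "strict_mono (\<lambda>k. N + r k)" using r by (simp add: strict_mono_def)
    ultimately show ?thesis using Y.MCauchy_convergent_subsequence[OF Cauchy] by blast
  qed
  then show ?thesis unfolding mcomplete_of_def Y.mcomplete_def by blast
qed

section \<open>Lattice nets\<close>

definition int_lattice :: "'a::euclidean_space set" where
  "int_lattice = {v. \<forall>b\<in>Basis. v \<bullet> b \<in> \<int>}"

lemma finite_int_lattice_ball: "finite {v \<in> int_lattice. norm (v :: 'a::euclidean_space) \<le> K}"
proof (rule finite_imageD)
  let ?coords = "\<lambda>v::'a. restrict (\<lambda>b. v \<bullet> b) Basis"
  have "?coords ` {v \<in> int_lattice. norm v \<le> K} \<subseteq> Basis \<rightarrow>\<^sub>E {k \<in> \<int>. \<bar>k\<bar> \<le> K}"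
    by (auto simp: int_lattice_def intro: order_trans[OF Basis_le_norm])
  then show "finite (?coords ` {v \<in> int_lattice. norm v \<le> K})"
    by (rule finite_subset) (intro finite_PiE finite_Basis finite_abs_int_segment)
  show "inj_on ?coords {v \<in> int_lattice. norm v \<le> K}"
  proof (rule inj_onI)
    fix u v :: 'a assume "?coords u = ?coords v"
    then have "u \<bullet> b = v \<bullet> b" if "b \<in> Basis" for b using that by (metis restrict_apply')
    then show "u = v" by (rule euclidean_eqI)
  qed
qed

lemma countable_int_lattice: "countable (int_lattice :: 'a::euclidean_space set)"
proof -
  have "countable (\<Union>k::nat. {v \<in> int_lattice. norm (v :: 'a) \<le> real k})"
    by (rule countable_UN) (auto intro: countable_finite finite_int_lattice_ball)
  moreover have "v \<in> (\<Union>k::nat. {v \<in> int_lattice. norm v \<le> real k})"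
    if "v \<in> int_lattice" for v :: 'a
    using that real_arch_simple[of "norm v"] by blast
  then have "(int_lattice :: 'a set) \<subseteq> (\<Union>k::nat. {v \<in> int_lattice. norm v \<le> real k})" ..
  ultimately show ?thesis by (rule countable_subset[rotated])
qed

lemma int_lattice_rounding: "\<exists>v\<in>int_lattice. norm (p - v) \<le> DIM('a)" for p :: "'a::euclidean_space"
proof -
  define v :: 'a where "v = (\<Sum>b\<in>Basis. of_int \<lfloor>p \<bullet> b\<rfloor> *\<^sub>R b)"
  have v: "v \<bullet> b = of_int \<lfloor>p \<bullet> b\<rfloor>" if "b \<in> Basis" for b
    using that by (simp add: v_def)
  have "norm (p - v) \<le> (\<Sum>b\<in>Basis. \<bar>(p - v) \<bullet> b\<bar>)" by (rule norm_le_l1)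
  also have "\<dots> \<le> (\<Sum>b\<in>(Basis::'a set). 1)"
  proof (rule sum_mono)
    fix b :: 'a assume "b \<in> Basis"
    then have "(p - v) \<bullet> b = p \<bullet> b - of_int \<lfloor>p \<bullet> b\<rfloor>" using v by (simp add: inner_diff_left)
    then show "\<bar>(p - v) \<bullet> b\<bar> \<le> 1" by linarith
  qed
  finally have "norm (p - v) \<le> DIM('a)" by simp
  moreover have "v \<in> int_lattice" using v by (simp add: int_lattice_def)
  ultimately show ?thesis by blast
qed

text \<open>The nets are scaled copies of the integer lattice. Translating by a lattice point close to \<open>p\<close>
  and rescaling maps the net points near \<open>p\<close> into a fixed ball of the integer lattice, which bounds
  their number uniformly.\<close>

lemma euclidean_nets:
  "\<exists>D. \<forall>s>0. \<exists>N::'a::euclidean_space set. countable N \<and> (\<forall>p. \<exists>q\<in>N. dist p q \<le> s) \<and>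
     (\<forall>p. finite {q \<in> N. dist p q \<le> K * s} \<and> card {q \<in> N. dist p q \<le> K * s} \<le> D)"
proof (rule exI[of _ "card {v \<in> int_lattice. norm (v :: 'a) \<le> (K + 1) * DIM('a)}"], intro allI impI)
  fix s :: real assume s: "0 < s"
  define \<delta> where "\<delta> = s / DIM('a)"
  have \<delta>: "0 < \<delta>" "\<delta> * DIM('a) = s" using s by (simp_all add: \<delta>_def)
  let ?N = "(\<lambda>v::'a. \<delta> *\<^sub>R v) ` int_lattice"
  let ?G = "{v \<in> int_lattice. norm (v :: 'a) \<le> (K + 1) * DIM('a)}"
  have cover: "\<exists>v\<in>int_lattice. dist p (\<delta> *\<^sub>R v) \<le> s" for p :: 'a
  proof -
    obtain v where v: "v \<in> int_lattice" "norm ((1 / \<delta>) *\<^sub>R p - v) \<le> DIM('a)"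
      using int_lattice_rounding by blast
    have "p - \<delta> *\<^sub>R v = \<delta> *\<^sub>R ((1 / \<delta>) *\<^sub>R p - v)" using \<delta> by (simp add: scaleR_diff_right)
    then have "dist p (\<delta> *\<^sub>R v) = \<delta> * norm ((1 / \<delta>) *\<^sub>R p - v)" using \<delta>(1) by (simp add: dist_norm)
    also have "\<dots> \<le> s" using v(2) \<delta> mult_left_mono[OF v(2), of \<delta>] by simp
    finally show ?thesis using v(1) by blast
  qed
  have count: "finite {q \<in> ?N. dist p q \<le> K * s} \<and> card {q \<in> ?N. dist p q \<le> K * s} \<le> card ?G" for p
  proof -
    obtain u where u: "u \<in> int_lattice" "dist p (\<delta> *\<^sub>R u) \<le> s" using cover by blast
    have sub: "{q \<in> ?N. dist p q \<le> K * s} \<subseteq> (\<lambda>w. \<delta> *\<^sub>R (u + w)) ` ?G"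
    proof
      fix q assume "q \<in> {q \<in> ?N. dist p q \<le> K * s}"
      then obtain v where v: "v \<in> int_lattice" "q = \<delta> *\<^sub>R v" "dist p (\<delta> *\<^sub>R v) \<le> K * s" by blast
      have "\<delta> * norm (v - u) = dist (\<delta> *\<^sub>R v) (\<delta> *\<^sub>R u)"
        using \<delta>(1) by (simp add: dist_norm flip: scaleR_diff_right)
      also have "\<dots> \<le> (K + 1) * s"
        using u(2) v(3) dist_triangle3[of "\<delta> *\<^sub>R v" "\<delta> *\<^sub>R u" p] by (simp add: algebra_simps)
      also have "\<dots> = \<delta> * ((K + 1) * DIM('a))" using \<delta>(2) by (simp add: algebra_simps)
      finally have "norm (v - u) \<le> (K + 1) * DIM('a)" using \<delta>(1) by simp
      then have "v - u \<in> ?G" using u(1) v(1) by (auto simp: int_lattice_def inner_diff_left)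
      then show "q \<in> (\<lambda>w. \<delta> *\<^sub>R (u + w)) ` ?G" using v(2) by (intro image_eqI[of _ _ "v - u"]) auto
    qed
    have fin: "finite ?G" by (rule finite_int_lattice_ball)
    show ?thesis
      using finite_subset[OF sub finite_imageI[OF fin]] card_mono[OF finite_imageI[OF fin] sub]
        card_image_le[OF fin, of "\<lambda>w. \<delta> *\<^sub>R (u + w)"] by linarith
  qed
  show "\<exists>N::'a set. countable N \<and> (\<forall>p. \<exists>q\<in>N. dist p q \<le> s) \<and>
     (\<forall>p. finite {q \<in> N. dist p q \<le> K * s} \<and> card {q \<in> N. dist p q \<le> K * s} \<le> card ?G)"
  proof (intro exI[of _ ?N] conjI allI)
    show "countable ?N" using countable_int_lattice by (rule countable_image)
    show "\<exists>q\<in>?N. dist p q \<le> s" for p using cover[of p] by blast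
  qed (use count in blast)+
qed

text \<open>The nets consist of the sets of lattice points. Rounding each element to the lattice shows
  that they are dense enough; and a set of lattice points close to \<open>A\<close> is a subset of the boundedly many
  lattice points close to elements of \<open>A\<close>.\<close>

lemma sets_upto_has_uniform_nets:
  "has_uniform_nets (sets_upto n :: 'a::euclidean_space set metric)"
  unfolding has_uniform_nets_def
proof
  fix K :: real
  let ?Y = "sets_upto n :: 'a set metric"
  from euclidean_nets[of K] obtain D where
    D: "\<forall>s>0. \<exists>N::'a set. countable N \<and> (\<forall>p. \<exists>q\<in>N. dist p q \<le> s) \<and>
     (\<forall>p. finite {q \<in> N. dist p q \<le> K * s} \<and> card {q \<in> N. dist p q \<le> K * s} \<le> D)" ..
  show "\<exists>D. \<forall>s>0. \<exists>N\<subseteq>mspace ?Y. countable N \<and>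
        (\<forall>x\<in>mspace ?Y. \<exists>p\<in>N. mdist ?Y x p \<le> s) \<and>
        (\<forall>x\<in>mspace ?Y. finite {p \<in> N. mdist ?Y x p \<le> K * s} \<and>
                       card {p \<in> N. mdist ?Y x p \<le> K * s} \<le> D)"
  proof (rule exI[of _ "2 ^ (n * D)"], intro allI impI)
    fix s :: real assume "0 < s"
    from D[rule_format, OF this] obtain N where N: "countable N" "\<And>p::'a. \<exists>q\<in>N. dist p q \<le> s"
      "\<And>p. finite {q \<in> N. dist p q \<le> K * s}" "\<And>p. card {q \<in> N. dist p q \<le> K * s} \<le> D"
      by blast
    define NN where "NN = {B \<in> mspace ?Y. B \<subseteq> N}"
    have "NN \<subseteq> {B. finite B \<and> B \<subseteq> N}" unfolding NN_def in_sets_upto by blast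
    then have "countable NN"
      using countable_Collect_finite_subset[OF N(1)] by (rule countable_subset)
    moreover have "\<exists>B\<in>NN. mdist ?Y A B \<le> s" if A: "A \<in> mspace ?Y" for A
    proof -
      obtain \<rho> where \<rho>: "\<And>p. \<rho> p \<in> N" "\<And>p. dist p (\<rho> p) \<le> s" using N(2) by metis
      have "mdist ?Y A (\<rho> ` A) \<le> s"
        unfolding mdist_sets_upto_le_iff[OF A image_in_sets_upto[OF A]] using \<rho>(2) by blast
      then show ?thesis using \<rho>(1) image_in_sets_upto[OF A] by (intro bexI[of _ "\<rho> ` A"]) (auto simp: NN_def)
    qed
    moreover have "finite {B \<in> NN. mdist ?Y A B \<le> K * s} \<and>
        card {B \<in> NN. mdist ?Y A B \<le> K * s} \<le> 2 ^ (n * D)" if A: "A \<in> mspace ?Y" for A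
    proof -
      let ?U = "\<Union>p\<in>A. {q \<in> N. dist p q \<le> K * s}"
      have finA: "finite A" "card A \<le> n" using A by (simp_all add: in_sets_upto)
      have finU: "finite ?U" using finA(1) N(3) by blast
      have "card ?U \<le> (\<Sum>p\<in>A. card {q \<in> N. dist p q \<le> K * s})" using finA(1) by (rule card_UN_le)
      also have "\<dots> \<le> (\<Sum>p\<in>A. D)" by (intro sum_mono N(4))
      also have "\<dots> \<le> n * D" using finA(2) by simp
      finally have "card (Pow ?U) \<le> 2 ^ (n * D)" using finU by (simp add: card_Pow)
      moreover have "{B \<in> NN. mdist ?Y A B \<le> K * s} \<subseteq> Pow ?U"
      proof
        fix B assume "B \<in> {B \<in> NN. mdist ?Y A B \<le> K * s}"
        then have B: "B \<in> mspace ?Y" "B \<subseteq> N" "mdist ?Y A B \<le> K * s" by (auto simp: NN_def)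
        show "B \<in> Pow ?U" using mdist_sets_uptoD(2)[OF A B(1,3)] B(2) by blast
      qed
      ultimately show ?thesis
        using finU by (meson card_mono finite_Pow_iff finite_subset order_trans)
    qed
    ultimately show "\<exists>N\<subseteq>mspace ?Y. countable N \<and>
        (\<forall>x\<in>mspace ?Y. \<exists>p\<in>N. mdist ?Y x p \<le> s) \<and>
        (\<forall>x\<in>mspace ?Y. finite {p \<in> N. mdist ?Y x p \<le> K * s} \<and>
                       card {p \<in> N. mdist ?Y x p \<le> K * s} \<le> 2 ^ (n * D))"
      by (intro exI[of _ NN]) (auto simp: NN_def)
  qed
qed

section \<open>Finite subsets of Euclidean space\<close>

theorem corollary1p2:
  fixes n :: nat
  assumes "n \<ge> 1"
  shows "absolute_Lipschitz_retract TYPE('z)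
           (finite_subset_metric (euclidean_metric :: (real ^ 'd) metric) n)"
proof (rule absolute_Lipschitz_retract_if_nets_and_contractions[where C = "real (4 * n * n + 1)"])
  let ?Y = "sets_upto n :: (real ^ 'd) set metric"
  have "{0} \<in> mspace ?Y"
    unfolding in_sets_upto using assms by simp
  then show "mspace ?Y \<noteq> {}" by blast
  show "mcomplete_of ?Y" by (rule mcomplete_sets_upto)
  show "has_uniform_nets ?Y" by (rule sets_upto_has_uniform_nets)
  show "1 \<le> real (4 * n * n + 1)" by simp
  show "\<exists>h. ball_contraction ?Y (real (4 * n * n + 1)) A R h"
    if "A \<in> mspace ?Y" "0 < R" for A R
    using that by (rule sets_upto_ball_contraction)
qed

end
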